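(* Let $m\ge 0$, $\mathcal{R}=\mathbb{C}[x]/(x^{m+1})$ and $\mathfrak{N}=x\in\mathcal{R}$ (so $\mathfrak{N}^{m+1}=0$). Let $F$ be a formal power series, or a function analytic at the origin, whose truncated evaluation in $\mathcal{R}$ can be constructed by a finite composition of elementary operations on truncated series (addition, multiplication, differentiation, composition, and inversion when the constant term is invertible). Then the arithmetic cost of computing $F(\mathfrak{N})$ satisfies $$\mathrm{cost}\bigl(F(\mathfrak{N})\bigr)=O\bigl(M_{\mathcal{R}}(m)\bigr).$$
   Context: Costs are numbers of scalar operations in the arithmetic circuit model over $\mathbb{C}$. $M_{\mathcal{R}}(m)$ denotes the arithmetic cost of computing one product in $\mathcal{R}=\mathbb{C}[x]/(x^{m+1})$; the paper takes it to be superadditive in the sense $M_{\mathcal{R}}(2n)\ge 2M_{\mathcal{R}}(n)$. For $F(z)=\sum_{k\ge0} f_kz^k$ the evaluation is $F(\mathfrak{N}):=\sum_{k\ge 0}f_k\mathfrak{N}^k$, which equals $\sum_{k=0}^m f_k\mathfrak{N}^k$ because $\mathfrak{N}^{m+1}=0$. The asymptotic statement is for $m\to\infty$ with the finite composition of elementary operations defining $F$ fixed. *)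

theory Defs
  imports
    "HOL-Complex_Analysis.Complex_Analysis"
    "HOL-Computational_Algebra.Computational_Algebra"
    "HOL-Library.Landau_Symbols"
begin

text \<open>
  A circuit is a straight-line program: every gate performs one scalar operation, and its operands
  are scalar constants, inputs, or the results of earlier gates (wires, numbered from 0).
  Constants and inputs are free; the size is the number of gates.  The set \<open>K\<close> of
  constants a circuit may mention is a parameter: \<open>K = UNIV\<close> is the usual arithmetic circuit
  model over the complex numbers.  A proper subset \<open>K\<close> rules out circuits in which the numbers to
  be computed are simply written down as constants.
\<close>

datatype operand = Scalar complex | Input nat | Wire nat

datatype operation = Add | Sub | Mul | Div

datatype gate = Gate operation operand operand

primrec operand_ok :: "complex set \<Rightarrow> complex list \<Rightarrow> complex list \<Rightarrow> operand \<Rightarrow> bool" where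
  "operand_ok K xs ws (Scalar c) \<longleftrightarrow> c \<in> K"
| "operand_ok K xs ws (Input i) \<longleftrightarrow> i < length xs"
| "operand_ok K xs ws (Wire j) \<longleftrightarrow> j < length ws"

primrec operand_val :: "complex list \<Rightarrow> complex list \<Rightarrow> operand \<Rightarrow> complex" where
  "operand_val xs ws (Scalar c) = c"
| "operand_val xs ws (Input i) = xs ! i"
| "operand_val xs ws (Wire j) = ws ! j"

primrec apply_op :: "operation \<Rightarrow> complex \<Rightarrow> complex \<Rightarrow> complex" where
  "apply_op Add a b = a + b"
| "apply_op Sub a b = a - b"
| "apply_op Mul a b = a * b"
| "apply_op Div a b = a / b"

primrec gate_ok :: "complex set \<Rightarrow> complex list \<Rightarrow> complex list \<Rightarrow> gate \<Rightarrow> bool" where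
  "gate_ok K xs ws (Gate f a b) \<longleftrightarrow>
     operand_ok K xs ws a \<and> operand_ok K xs ws b \<and> (f = Div \<longrightarrow> operand_val xs ws b \<noteq> 0)"

primrec gate_val :: "complex list \<Rightarrow> complex list \<Rightarrow> gate \<Rightarrow> complex" where
  "gate_val xs ws (Gate f a b) = apply_op f (operand_val xs ws a) (operand_val xs ws b)"

primrec gates_ok :: "complex set \<Rightarrow> complex list \<Rightarrow> complex list \<Rightarrow> gate list \<Rightarrow> bool" where
  "gates_ok K xs ws [] \<longleftrightarrow> True"
| "gates_ok K xs ws (g # gs) \<longleftrightarrow>
     gate_ok K xs ws g \<and> gates_ok K xs (ws @ [gate_val xs ws g]) gs"

primrec wires :: "complex list \<Rightarrow> complex list \<Rightarrow> gate list \<Rightarrow> complex list" where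
  "wires xs ws [] = ws"
| "wires xs ws (g # gs) = wires xs (ws @ [gate_val xs ws g]) gs"

definition computes ::
  "complex set \<Rightarrow> nat \<Rightarrow> gate list \<Rightarrow> operand list \<Rightarrow> (complex list \<Rightarrow> complex list) \<Rightarrow> bool" where
  "computes K n gs outs f \<longleftrightarrow>
     (\<forall>xs. length xs = n \<longrightarrow>
        gates_ok K xs [] gs \<and>
        (\<forall>s\<in>set outs. operand_ok K xs (wires xs [] gs) s) \<and>
        map (operand_val xs (wires xs [] gs)) outs = f xs)"

text \<open>
  The least size of a circuit computing \<open>f\<close> on \<open>n\<close> inputs.  It is used only for maps that some
  circuit computes; for other maps the value is meaningless.
\<close>

definition circuit_cost :: "complex set \<Rightarrow> nat \<Rightarrow> (complex list \<Rightarrow> complex list) \<Rightarrow> nat" where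
  "circuit_cost K n f = (LEAST k. \<exists>gs outs. length gs = k \<and> computes K n gs outs f)"

text \<open>
  An element of \<open>\<complex>[x]/(x^(m+1))\<close> is represented by its unique representative of degree at most
  \<open>m\<close>.  Computing it means computing its \<open>m + 1\<close> coordinates in the basis \<open>1, x, \<dots>, x^m\<close>.
\<close>

definition trunc_mod :: "nat \<Rightarrow> complex poly \<Rightarrow> complex poly" where
  "trunc_mod m p = p mod monom 1 (Suc m)"

definition coords :: "nat \<Rightarrow> complex poly \<Rightarrow> complex list" where
  "coords m p = map (coeff p) [0..<Suc m]"

definition nilp :: "nat \<Rightarrow> complex poly" where
  "nilp m = trunc_mod m (monom 1 1)"

text \<open>Terms with \<open>k > m\<close> vanish when \<open>a\<close> is a multiple of \<open>x\<close>.\<close>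

definition eval_trunc :: "nat \<Rightarrow> complex fps \<Rightarrow> complex poly \<Rightarrow> complex poly" where
  "eval_trunc m F a = trunc_mod m (\<Sum>k\<le>m. smult (fps_nth F k) (a ^ k))"

text \<open>The first \<open>m + 1\<close> inputs are the coordinates of one factor, the others those of the other.\<close>

definition mult_cost :: "nat \<Rightarrow> nat" where
  "mult_cost m = circuit_cost UNIV (2 * Suc m)
     (\<lambda>xs. coords m (trunc_mod m (Poly (take (Suc m) xs) * Poly (drop (Suc m) xs))))"

definition eval_cost :: "complex set \<Rightarrow> complex fps \<Rightarrow> nat \<Rightarrow> nat" where
  "eval_cost K F m = circuit_cost (K \<union> {0, 1}) 0 (\<lambda>_. coords m (eval_trunc m F (nilp m)))"

text \<open>
  \<open>constructible K F\<close>: the series \<open>F\<close> arises from the indeterminate and scalars in \<open>K\<close> by a finite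
  composition of elementary operations.  The operations act on full series, and truncation takes
  place at the end, because differentiation does not descend to \<open>\<complex>[x]/(x^(m+1))\<close>.  The inner series
  of a composition must have constant term 0 for the composition to be defined.  Neither \<open>K\<close> nor
  the derivation depends on the truncation order \<open>m\<close>.
\<close>

inductive constructible :: "complex set \<Rightarrow> complex fps \<Rightarrow> bool" for K :: "complex set" where
  indeterminate: "constructible K fps_X"
| scalar: "c \<in> K \<Longrightarrow> constructible K (fps_const c)"
| add: "constructible K F \<Longrightarrow> constructible K G \<Longrightarrow> constructible K (F + G)"
| mult: "constructible K F \<Longrightarrow> constructible K G \<Longrightarrow> constructible K (F * G)"
| deriv: "constructible K F \<Longrightarrow> constructible K (fps_deriv F)"
| compose: "constructible K F \<Longrightarrow> constructible K G \<Longrightarrow> fps_nth G 0 = 0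
    \<Longrightarrow> constructible K (fps_compose F G)"
| invert: "constructible K F \<Longrightarrow> fps_nth F 0 \<noteq> 0 \<Longrightarrow> constructible K (inverse F)"

end

theory Submission
  imports Defs
begin

text \<open>
  Every constructible series is rational over the subfield of \<open>\<complex>\<close> generated by \<open>K\<close>: rational
  functions without pole at the origin contain \<open>x\<close> and the scalars and are closed under sums,
  products, derivatives, compositions and inverses (\<open>constructible_imp_rational\<close>).  Writing
  \<open>F = P / Q\<close> with \<open>Q 0 \<noteq> 0\<close>, the equation \<open>Q F = P\<close> is a linear recurrence of order \<open>degree Q\<close> for
  the coefficients of \<open>F\<close>.  The coefficients of \<open>P\<close> and \<open>Q\<close> come from \<open>K\<close> by finitely many field
  operations, a cost that does not depend on \<open>m\<close>; after that each coefficient of \<open>F\<close> costs a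
  bounded number of gates.  As \<open>F(\<NN>)\<close> has the coordinates \<open>f\<^sub>0, \<dots>, f\<^sub>m\<close>, its cost is \<open>O(m + 1)\<close>
  (\<open>eval_cost_linear\<close>).

  On the other side, a product in \<open>\<complex>[x]/(x^(m+1))\<close> has \<open>m + 1\<close> coordinates that are pairwise
  different functions of the inputs, none of them constant or equal to an input.  A circuit thus
  spends a separate gate on each, so a multiplication costs at least \<open>m + 1\<close>
  (\<open>mult_cost_lower_bound\<close>).
\<close>

section \<open>Families of functions computed by one circuit\<close>

lemma wires_append: "wires xs ws (gs @ hs) = wires xs (wires xs ws gs) hs"
  by (induction gs arbitrary: ws) auto

lemma gates_ok_append:
  "gates_ok K xs ws (gs @ hs) \<longleftrightarrow> gates_ok K xs ws gs \<and> gates_ok K xs (wires xs ws gs) hs"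
  by (induction gs arbitrary: ws) auto

lemma length_wires: "length (wires xs ws gs) = length ws + length gs"
  by (induction gs arbitrary: ws) auto

lemma operand_ok_append: "operand_ok K xs ws s \<Longrightarrow> operand_ok K xs (ws @ vs) s"
  by (cases s) auto

lemma operand_val_append:
  "operand_ok K xs ws s \<Longrightarrow> operand_val xs (ws @ vs) s = operand_val xs ws s"
  by (cases s) (auto simp: nth_append)

text \<open>
  The functions form a set and not a list, so that a circuit can be extended gate by gate without
  keeping track of the wire that carries each function.
\<close>

definition jointly_computable ::
  "complex set \<Rightarrow> nat \<Rightarrow> nat \<Rightarrow> (complex list \<Rightarrow> complex) set \<Rightarrow> bool" where
  "jointly_computable K n c S \<longleftrightarrow>
     (\<exists>gs. length gs \<le> c \<and> (\<forall>xs. length xs = n \<longrightarrow> gates_ok K xs [] gs) \<and>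
        (\<forall>f\<in>S. \<exists>s. \<forall>xs. length xs = n \<longrightarrow>
           operand_ok K xs (wires xs [] gs) s \<and> operand_val xs (wires xs [] gs) s = f xs))"

lemma jointly_computable_empty: "jointly_computable K n 0 {}"
  unfolding jointly_computable_def by auto

lemma jointly_computable_subset:
  "jointly_computable K n c S \<Longrightarrow> T \<subseteq> S \<Longrightarrow> jointly_computable K n c T"
  unfolding jointly_computable_def by (meson subsetD)

lemma jointly_computable_operand:
  assumes "jointly_computable K n c S"
    and "\<And>xs ws. length xs = n \<Longrightarrow> operand_ok K xs ws s \<and> operand_val xs ws s = f xs"
  shows "jointly_computable K n c (insert f S)"
proof -
  obtain gs where "length gs \<le> c" "\<forall>xs. length xs = n \<longrightarrow> gates_ok K xs [] gs"
    and "\<forall>f\<in>S. \<exists>s. \<forall>xs. length xs = n \<longrightarrow>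
      operand_ok K xs (wires xs [] gs) s \<and> operand_val xs (wires xs [] gs) s = f xs"
    using assms(1) unfolding jointly_computable_def by blast
  then show ?thesis
    unfolding jointly_computable_def using assms(2) by (intro exI[of _ gs]) blast
qed

lemma jointly_computable_scalar:
  "jointly_computable K n c S \<Longrightarrow> z \<in> K \<Longrightarrow> jointly_computable K n c (insert (\<lambda>_. z) S)"
  by (rule jointly_computable_operand[where s = "Scalar z"]) auto

lemma jointly_computable_input:
  "jointly_computable K n c S \<Longrightarrow> i < n \<Longrightarrow> jointly_computable K n c (insert (\<lambda>xs. xs ! i) S)"
  by (rule jointly_computable_operand[where s = "Input i"]) auto

lemma jointly_computable_gate:
  assumes S: "jointly_computable K n c S" and "f \<in> S" "g \<in> S"
    and nz: "opr = Div \<Longrightarrow> (\<And>xs. length xs = n \<Longrightarrow> g xs \<noteq> 0)"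
  shows "jointly_computable K n (Suc c) (insert (\<lambda>xs. apply_op opr (f xs) (g xs)) S)"
proof -
  obtain gs where gs: "length gs \<le> c" "\<forall>xs. length xs = n \<longrightarrow> gates_ok K xs [] gs"
    and val: "\<forall>f\<in>S. \<exists>s. \<forall>xs. length xs = n \<longrightarrow>
      operand_ok K xs (wires xs [] gs) s \<and> operand_val xs (wires xs [] gs) s = f xs"
    using S unfolding jointly_computable_def by blast
  obtain a where a: "\<And>xs. length xs = n \<Longrightarrow>
      operand_ok K xs (wires xs [] gs) a \<and> operand_val xs (wires xs [] gs) a = f xs"
    using val \<open>f \<in> S\<close> by blast
  obtain b where b: "\<And>xs. length xs = n \<Longrightarrow>
      operand_ok K xs (wires xs [] gs) b \<and> operand_val xs (wires xs [] gs) b = g xs"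
    using val \<open>g \<in> S\<close> by blast
  define hs where "hs = gs @ [Gate opr a b]"
  have wires_hs: "wires xs [] hs = wires xs [] gs @ [apply_op opr (f xs) (g xs)]"
    if "length xs = n" for xs
    using a[OF that] b[OF that] by (simp add: hs_def wires_append)
  have "length hs \<le> Suc c"
    using gs(1) by (simp add: hs_def)
  moreover have "gates_ok K xs [] hs" if "length xs = n" for xs
    using gs(2) a[OF that] b[OF that] nz that by (auto simp: hs_def gates_ok_append)
  moreover have "\<exists>s. \<forall>xs. length xs = n \<longrightarrow>
      operand_ok K xs (wires xs [] hs) s \<and> operand_val xs (wires xs [] hs) s = h xs"
    if "h \<in> insert (\<lambda>xs. apply_op opr (f xs) (g xs)) S" for h
  proof (cases "h \<in> S")
    case True
    then obtain s where "\<forall>xs. length xs = n \<longrightarrow>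
        operand_ok K xs (wires xs [] gs) s \<and> operand_val xs (wires xs [] gs) s = h xs"
      using val by blast
    then show ?thesis
      by (intro exI[of _ s]) (auto simp: wires_hs operand_ok_append operand_val_append)
  next
    case False
    then have "h = (\<lambda>xs. apply_op opr (f xs) (g xs))"
      using that by blast
    then show ?thesis
      by (intro exI[of _ "Wire (length gs)"]) (simp add: wires_hs length_wires nth_append)
  qed
  ultimately show ?thesis
    unfolding jointly_computable_def by (intro exI[of _ hs]) blast
qed

lemma jointly_computable_imp_computes:
  assumes "jointly_computable K n c S" "set fs \<subseteq> S"
    and F: "\<And>xs. length xs = n \<Longrightarrow> F xs = map (\<lambda>f. f xs) fs"
  shows "\<exists>gs outs. length gs \<le> c \<and> computes K n gs outs F"
proof -
  obtain gs where gs: "length gs \<le> c" "\<forall>xs. length xs = n \<longrightarrow> gates_ok K xs [] gs"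
    and "\<forall>f\<in>S. \<exists>s. \<forall>xs. length xs = n \<longrightarrow>
      operand_ok K xs (wires xs [] gs) s \<and> operand_val xs (wires xs [] gs) s = f xs"
    using assms(1) unfolding jointly_computable_def by blast
  then obtain s where s: "\<And>f xs. f \<in> S \<Longrightarrow> length xs = n \<Longrightarrow>
      operand_ok K xs (wires xs [] gs) (s f) \<and> operand_val xs (wires xs [] gs) (s f) = f xs"
    by metis
  have "computes K n gs (map s fs) F"
    unfolding computes_def using gs(2) s assms(2) F by auto
  then show ?thesis
    using gs(1) by blast
qed

lemma circuit_cost_le:
  assumes "jointly_computable K n c S" "set fs \<subseteq> S"
    and "\<And>xs. length xs = n \<Longrightarrow> F xs = map (\<lambda>f. f xs) fs"
  shows "circuit_cost K n F \<le> c"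
proof -
  obtain gs outs where "length gs \<le> c" "computes K n gs outs F"
    using jointly_computable_imp_computes[OF assms] by blast
  then have "circuit_cost K n F \<le> length gs"
    unfolding circuit_cost_def by (intro Least_le) blast
  with \<open>length gs \<le> c\<close> show ?thesis
    by simp
qed

text \<open>
  The functions that some circuit computes, irrespective of its size.  A divisor must not vanish
  at any input, because a circuit divides at every input.
\<close>

inductive arithmetic :: "complex set \<Rightarrow> nat \<Rightarrow> (complex list \<Rightarrow> complex) \<Rightarrow> bool"
  for K :: "complex set" and n :: nat where
  scalar: "z \<in> K \<Longrightarrow> arithmetic K n (\<lambda>_. z)"
| input: "i < n \<Longrightarrow> arithmetic K n (\<lambda>xs. xs ! i)"
| gate: "arithmetic K n f \<Longrightarrow> arithmetic K n g \<Longrightarrow>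
    (opr = Div \<Longrightarrow> (\<And>xs. length xs = n \<Longrightarrow> g xs \<noteq> 0)) \<Longrightarrow>
    arithmetic K n (\<lambda>xs. apply_op opr (f xs) (g xs))"

lemma arithmetic_extend:
  assumes "arithmetic K n f" "jointly_computable K n c S"
  shows "\<exists>c'. jointly_computable K n c' (insert f S)"
  using assms
proof (induction arbitrary: c S rule: arithmetic.induct)
  case (scalar z)
  then show ?case
    using jointly_computable_scalar by blast
next
  case (input i)
  then show ?case
    using jointly_computable_input by blast
next
  case (gate f g opr)
  obtain c1 where "jointly_computable K n c1 (insert f S)"
    using gate.IH(1) gate.prems by blast
  then obtain c2 where c2: "jointly_computable K n c2 (insert g (insert f S))"
    using gate.IH(2) by blast
  have "jointly_computable K n (Suc c2)
      (insert (\<lambda>xs. apply_op opr (f xs) (g xs)) (insert g (insert f S)))"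
    by (rule jointly_computable_gate[OF c2]) (use gate.hyps in auto)
  then show ?case
    by (intro exI[of _ "Suc c2"]) (rule jointly_computable_subset, auto)
qed

lemma arithmetic_finite:
  assumes "finite T" "\<And>f. f \<in> T \<Longrightarrow> arithmetic K n f"
  shows "\<exists>c. jointly_computable K n c T"
  using assms
proof (induction T rule: finite_induct)
  case empty
  then show ?case
    using jointly_computable_empty by blast
next
  case (insert f T)
  then show ?case
    using arithmetic_extend by blast
qed

lemma arithmetic_sum:
  assumes "finite I" "0 \<in> K" "\<And>i. i \<in> I \<Longrightarrow> arithmetic K n (f i)"
  shows "arithmetic K n (\<lambda>xs. \<Sum>i\<in>I. f i xs)"
  using assms(1,3)
proof (induction I rule: finite_induct)
  case empty
  then show ?case
    using arithmetic.scalar[OF \<open>0 \<in> K\<close>] by simp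
next
  case (insert i I)
  have "arithmetic K n (\<lambda>xs. apply_op Add (f i xs) (\<Sum>i\<in>I. f i xs))"
    by (rule arithmetic.gate) (use insert in auto)
  then show ?case
    using insert.hyps by simp
qed

section \<open>Truncated polynomials\<close>

lemma coeff_trunc_mod:
  assumes "k \<le> m"
  shows "coeff (trunc_mod m p) k = coeff p k"
proof -
  let ?x = "monom 1 (Suc m) :: complex poly"
  have "coeff p k = coeff (?x * (p div ?x) + p mod ?x) k"
    by simp
  also have "\<dots> = coeff (p mod ?x) k"
    using assms by (simp only: coeff_add coeff_monom_mult) simp
  finally show ?thesis
    by (simp add: trunc_mod_def)
qed

lemma coords_eval_trunc_nilp:
  "coords m (eval_trunc m F (nilp m)) = map (fps_nth F) [0..<Suc m]"
proof -
  have "coeff (eval_trunc m F (nilp m)) k = fps_nth F k" if "k \<le> m" for k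
  proof (cases "m = 0")
    case True
    then show ?thesis
      using that by (simp add: eval_trunc_def coeff_trunc_mod)
  next
    case False
    then have "nilp m = monom 1 1"
      unfolding nilp_def trunc_mod_def by (intro mod_poly_less) (simp add: degree_monom_eq)
    then have "coeff (eval_trunc m F (nilp m)) k
        = (\<Sum>j\<le>m. fps_nth F j * (if j = k then 1 else 0))"
      using that by (simp add: eval_trunc_def coeff_trunc_mod coeff_sum monom_power)
    then show ?thesis
      using that by (simp add: if_distrib cong: if_cong)
  qed
  then show ?thesis
    by (simp add: coords_def)
qed

lemma coords_mult:
  assumes "length xs = 2 * Suc m"
  shows "coords m (trunc_mod m (Poly (take (Suc m) xs) * Poly (drop (Suc m) xs)))
    = map (\<lambda>k. \<Sum>i\<le>k. xs ! i * xs ! (Suc m + (k - i))) [0..<Suc m]"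
proof -
  have "coeff (trunc_mod m (Poly (take (Suc m) xs) * Poly (drop (Suc m) xs))) k
      = (\<Sum>i\<le>k. xs ! i * xs ! (Suc m + (k - i)))" if "k \<le> m" for k
    unfolding coeff_trunc_mod[OF that] coeff_mult
    by (intro sum.cong refl) (use that assms in \<open>auto simp: nth_default_def\<close>)
  then show ?thesis
    by (simp add: coords_def)
qed

section \<open>A linear lower bound for multiplication\<close>

text \<open>
  The least size in \<open>mult_cost\<close> is attained because the naive multiplication is a circuit.
\<close>

lemma mult_circuit_exists:
  "\<exists>gs outs. length gs = mult_cost m \<and> computes UNIV (2 * Suc m) gs outs
     (\<lambda>xs. coords m (trunc_mod m (Poly (take (Suc m) xs) * Poly (drop (Suc m) xs))))"
proof -
  define h :: "nat \<Rightarrow> complex list \<Rightarrow> complex"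
    where "h k = (\<lambda>xs. \<Sum>i\<le>k. xs ! i * xs ! (Suc m + (k - i)))" for k
  have "arithmetic UNIV (2 * Suc m) (h k)" if "k \<le> m" for k
    unfolding h_def
  proof (rule arithmetic_sum)
    fix i assume "i \<in> {..k}"
    then have "arithmetic UNIV (2 * Suc m) (\<lambda>xs. apply_op Mul (xs ! i) (xs ! (Suc m + (k - i))))"
      using that by (intro arithmetic.gate arithmetic.input) auto
    then show "arithmetic UNIV (2 * Suc m) (\<lambda>xs. xs ! i * xs ! (Suc m + (k - i)))"
      by simp
  qed auto
  then have "\<exists>c. jointly_computable UNIV (2 * Suc m) c (set (map h [0..<Suc m]))"
    by (intro arithmetic_finite) auto
  then obtain c where "jointly_computable UNIV (2 * Suc m) c (set (map h [0..<Suc m]))"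
    by blast
  then have "\<exists>gs outs. length gs \<le> c \<and> computes UNIV (2 * Suc m) gs outs
      (\<lambda>xs. coords m (trunc_mod m (Poly (take (Suc m) xs) * Poly (drop (Suc m) xs))))"
    by (rule jointly_computable_imp_computes[OF _ order_refl])
       (simp only: coords_mult h_def map_map o_def)
  then have "\<exists>k gs outs. length gs = k \<and> computes UNIV (2 * Suc m) gs outs
      (\<lambda>xs. coords m (trunc_mod m (Poly (take (Suc m) xs) * Poly (drop (Suc m) xs))))"
    by blast
  then show ?thesis
    unfolding mult_cost_def circuit_cost_def by (rule LeastI_ex)
qed

text \<open>
  Multiplying \<open>2\<close> by \<open>2 x^k\<close> separates the \<open>k\<close>-th coordinate, which is \<open>4\<close>, from the other
  coordinates, which are \<open>0\<close>, and from the inputs, which are \<open>0\<close> or \<open>2\<close>.  It is not a constant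
  because \<open>0 \<cdot> 0 = 0\<close>.  So the outputs are different wires.
\<close>

lemma mult_cost_lower_bound: "Suc m \<le> mult_cost m"
proof -
  define f where "f = (\<lambda>xs. coords m (trunc_mod m
    (Poly (take (Suc m) xs) * Poly (drop (Suc m) xs))))"
  obtain gs outs where gs: "length gs = mult_cost m" and "computes UNIV (2 * Suc m) gs outs f"
    using mult_circuit_exists unfolding f_def by blast
  then have ok: "\<And>xs s. length xs = 2 * Suc m \<Longrightarrow> s \<in> set outs \<Longrightarrow>
      operand_ok UNIV xs (wires xs [] gs) s"
    and val: "\<And>xs. length xs = 2 * Suc m \<Longrightarrow> map (operand_val xs (wires xs [] gs)) outs = f xs"
    unfolding computes_def by blast+
  define zero :: "complex list" where "zero = replicate (2 * Suc m) 0"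
  define test :: "nat \<Rightarrow> complex list"
    where "test k = zero[0 := 2, Suc m + k := 2]" for k
  have len: "length zero = 2 * Suc m" "length (test k) = 2 * Suc m" for k
    by (simp_all add: zero_def test_def del: replicate_Suc)
  have "length outs = length (f zero)"
    using val[OF len(1)] by (metis length_map)
  then have outs: "length outs = Suc m"
    by (simp add: f_def coords_def)
  have val_nth: "operand_val xs (wires xs [] gs) (outs ! k)
      = (\<Sum>i\<le>k. xs ! i * xs ! (Suc m + (k - i)))"
    if "length xs = 2 * Suc m" "k \<le> m" for xs k
  proof -
    have "operand_val xs (wires xs [] gs) (outs ! k) = f xs ! k"
      using outs that by (simp flip: val)
    then show ?thesis
      using that by (simp add: f_def coords_mult del: upt_Suc)
  qed
  have zero_nth: "zero ! i = 0" if "i < 2 * Suc m" for i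
    using that unfolding zero_def by (rule nth_replicate)
  have test_nth: "test k ! i = (if i = 0 \<or> i = Suc m + k then 2 else 0)"
    if "i < 2 * Suc m" "k \<le> m" for i k
    using that zero_nth[OF that(1)] len(1) by (auto simp: test_def nth_list_update)
  have val_zero: "operand_val zero (wires zero [] gs) (outs ! k) = 0" if "k \<le> m" for k
    unfolding val_nth[OF len(1) that] by (rule sum.neutral) (use that in \<open>auto simp: zero_nth\<close>)
  have val_test: "operand_val (test k) (wires (test k) [] gs) (outs ! l) = (if l = k then 4 else 0)"
    if "k \<le> m" "l \<le> m" for k l
  proof -
    \<comment> \<open>The first factor is constant, so only the term \<open>i = 0\<close> contributes.\<close>
    have "(\<Sum>i\<le>l. test k ! i * test k ! (Suc m + (l - i)))
        = (\<Sum>i\<le>l. if i = 0 then (if l = k then 4 else 0) else 0)"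
      by (intro sum.cong refl) (use that in \<open>auto simp: test_nth\<close>)
    then show ?thesis
      using val_nth[OF len(2) that(2)] by simp
  qed
  have "\<exists>j<length gs. outs ! k = Wire j" if k: "k \<le> m" for k
  proof -
    have ok_k: "operand_ok UNIV (test k) (wires (test k) [] gs) (outs ! k)"
      using ok[OF len(2)] outs k by simp
    show ?thesis
    proof (cases "outs ! k")
      case (Scalar c)
      then show ?thesis
        using val_zero[OF k] val_test[OF k k] by simp
    next
      case (Input i)
      then show ?thesis
        using ok_k val_test[OF k k] len test_nth[OF _ k] by (simp split: if_splits)
    next
      case (Wire j)
      then show ?thesis
        using ok_k by (simp add: length_wires)
    qed
  qed
  then have sub: "(\<lambda>k. outs ! k) ` {..m} \<subseteq> Wire ` {..<length gs}"
    by fastforce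
  have "inj_on (\<lambda>k. outs ! k) {..m}"
  proof (rule inj_onI)
    fix k l assume "k \<in> {..m}" "l \<in> {..m}" and eq: "outs ! k = outs ! l"
    then have "k \<le> m" "l \<le> m"
      by simp_all
    then have "(if l = k then 4 else 0) = (4 :: complex)"
      using val_test[of k l] val_test[of k k] unfolding eq by simp
    then show "k = l"
      by (cases "l = k") simp_all
  qed
  then have "card {..m} \<le> card (Wire ` {..<length gs})"
    using sub by (rule card_inj_on_le) simp
  also have "\<dots> \<le> length gs"
    using card_image_le[of "{..<length gs}" Wire] by simp
  finally show ?thesis
    using gs by simp
qed

section \<open>Rational power series over a subfield\<close>

locale complex_subfield =
  fixes E :: "complex set"
  assumes zero_mem: "0 \<in> E"
    and one_mem: "1 \<in> E"
    and add_mem: "a \<in> E \<Longrightarrow> b \<in> E \<Longrightarrow> a + b \<in> E"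
    and diff_mem: "a \<in> E \<Longrightarrow> b \<in> E \<Longrightarrow> a - b \<in> E"
    and mult_mem: "a \<in> E \<Longrightarrow> b \<in> E \<Longrightarrow> a * b \<in> E"
    and divide_mem: "a \<in> E \<Longrightarrow> b \<in> E \<Longrightarrow> b \<noteq> 0 \<Longrightarrow> a / b \<in> E"
begin

lemma of_nat_mem: "of_nat n \<in> E"
  by (induction n) (auto simp: zero_mem one_mem add_mem)

lemma sum_mem: "(\<And>i. i \<in> I \<Longrightarrow> f i \<in> E) \<Longrightarrow> sum f I \<in> E"
  by (induction I rule: infinite_finite_induct) (auto simp: zero_mem add_mem)

definition over :: "complex poly \<Rightarrow> bool" where
  "over P \<longleftrightarrow> (\<forall>i. coeff P i \<in> E)"

lemma over_pCons: "over (pCons a P) \<longleftrightarrow> a \<in> E \<and> over P"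
  unfolding over_def by (auto simp: coeff_pCons split: nat.splits)

lemma over_0: "over 0"
  by (simp add: over_def zero_mem)

lemma over_add: "over P \<Longrightarrow> over Q \<Longrightarrow> over (P + Q)"
  by (simp add: over_def add_mem)

lemma over_diff: "over P \<Longrightarrow> over Q \<Longrightarrow> over (P - Q)"
  by (simp add: over_def diff_mem)

lemma over_mult: "over P \<Longrightarrow> over Q \<Longrightarrow> over (P * Q)"
  by (auto simp: over_def coeff_mult intro!: sum_mem mult_mem)

lemma over_pderiv: "over P \<Longrightarrow> over (pderiv P)"
  using of_nat_mem[of "Suc _"]
  by (auto simp: over_def coeff_pderiv simp del: of_nat_Suc intro!: mult_mem)

definition rational :: "complex fps \<Rightarrow> bool" where
  "rational F \<longleftrightarrow> (\<exists>P Q. over P \<and> over Q \<and> coeff Q 0 \<noteq> 0 \<and> F * fps_of_poly Q = fps_of_poly P)"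

lemma rationalI:
  "over P \<Longrightarrow> over Q \<Longrightarrow> coeff Q 0 \<noteq> 0 \<Longrightarrow> F * fps_of_poly Q = fps_of_poly P \<Longrightarrow> rational F"
  unfolding rational_def by blast

lemma rationalE:
  assumes "rational F"
  obtains P Q where "over P" "over Q" "coeff Q 0 \<noteq> 0" "F * fps_of_poly Q = fps_of_poly P"
  using assms unfolding rational_def by blast

lemma rational_poly: "over P \<Longrightarrow> rational (fps_of_poly P)"
  by (rule rationalI[of P "[:1:]"]) (auto simp: over_pCons over_0 one_mem)

lemma rational_const: "a \<in> E \<Longrightarrow> rational (fps_const a)"
  using rational_poly[of "[:a:]"] by (simp add: over_pCons over_0 fps_of_poly_const)

lemma rational_X: "rational fps_X"
  using rational_poly[of "[:0, 1:]"] by (simp add: over_pCons over_0 zero_mem one_mem)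

lemma rational_add:
  assumes "rational F" "rational G"
  shows "rational (F + G)"
proof -
  obtain P Q where F: "over P" "over Q" "coeff Q 0 \<noteq> 0" "F * fps_of_poly Q = fps_of_poly P"
    using assms(1) by (rule rationalE)
  obtain A B where G: "over A" "over B" "coeff B 0 \<noteq> 0" "G * fps_of_poly B = fps_of_poly A"
    using assms(2) by (rule rationalE)
  have "(F + G) * fps_of_poly (Q * B) = fps_of_poly (P * B + A * Q)"
    by (simp add: fps_of_poly_mult fps_of_poly_add flip: F(4) G(4)) (simp add: algebra_simps)
  then show ?thesis
    using F(1-3) G(1-3) by (intro rationalI) (auto intro: over_add over_mult simp: coeff_mult)
qed

lemma rational_mult:
  assumes "rational F" "rational G"
  shows "rational (F * G)"
proof -
  obtain P Q where F: "over P" "over Q" "coeff Q 0 \<noteq> 0" "F * fps_of_poly Q = fps_of_poly P"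
    using assms(1) by (rule rationalE)
  obtain A B where G: "over A" "over B" "coeff B 0 \<noteq> 0" "G * fps_of_poly B = fps_of_poly A"
    using assms(2) by (rule rationalE)
  have "(F * G) * fps_of_poly (Q * B) = fps_of_poly (P * A)"
    by (simp add: fps_of_poly_mult algebra_simps flip: F(4) G(4))
  then show ?thesis
    using F(1-3) G(1-3) by (intro rationalI) (auto intro: over_mult simp: coeff_mult)
qed

text \<open>The quotient rule, read off from the derivative of \<open>F Q = P\<close>.\<close>

lemma rational_deriv:
  assumes "rational F"
  shows "rational (fps_deriv F)"
proof -
  obtain P Q where F: "over P" "over Q" "coeff Q 0 \<noteq> 0" "F * fps_of_poly Q = fps_of_poly P"
    using assms by (rule rationalE)
  have "fps_deriv F * fps_of_poly Q + F * fps_of_poly (pderiv Q) = fps_of_poly (pderiv P)"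
    using arg_cong[OF F(4), of fps_deriv] by (simp add: fps_of_poly_pderiv algebra_simps)
  then have "fps_of_poly (pderiv P * Q - P * pderiv Q)
      = (fps_deriv F * fps_of_poly Q + F * fps_of_poly (pderiv Q)) * fps_of_poly Q
        - (F * fps_of_poly Q) * fps_of_poly (pderiv Q)"
    by (simp only: fps_of_poly_mult fps_of_poly_diff F(4))
  also have "\<dots> = fps_deriv F * fps_of_poly (Q * Q)"
    by (simp add: fps_of_poly_mult algebra_simps)
  finally have "fps_deriv F * fps_of_poly (Q * Q) = fps_of_poly (pderiv P * Q - P * pderiv Q)"
    by (rule sym)
  then show ?thesis
    using F(1-3)
    by (intro rationalI) (auto intro: over_diff over_mult over_pderiv simp: coeff_mult)
qed

lemma rational_inverse:
  assumes "rational F" "fps_nth F 0 \<noteq> 0"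
  shows "rational (inverse F)"
proof -
  obtain P Q where F: "over P" "over Q" "coeff Q 0 \<noteq> 0" "F * fps_of_poly Q = fps_of_poly P"
    using assms(1) by (rule rationalE)
  have "coeff P 0 = fps_nth F 0 * coeff Q 0"
    using arg_cong[OF F(4), of "\<lambda>H. fps_nth H 0"] by simp
  then have "coeff P 0 \<noteq> 0"
    using assms(2) F(3) by simp
  moreover have "inverse F * fps_of_poly P = (inverse F * F) * fps_of_poly Q"
    by (simp only: mult.assoc F(4))
  then have "inverse F * fps_of_poly P = fps_of_poly Q"
    by (simp add: inverse_mult_eq_1[OF assms(2)])
  ultimately show ?thesis
    using F(1,2) by (intro rationalI)
qed

lemma rational_poly_compose:
  assumes "rational G" "fps_nth G 0 = 0"
  shows "over P \<Longrightarrow> rational (fps_of_poly P oo G)"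
proof (induction P rule: pCons_induct)
  case 0
  then show ?case
    using rational_poly[OF over_0] by simp
next
  case (pCons a P)
  have "fps_of_poly (pCons a P) oo G = fps_const a + G * (fps_of_poly P oo G)"
    using assms(2) by (simp add: fps_of_poly_pCons fps_compose_add_distrib
        fps_compose_mult_distrib mult.commute)
  then show ?case
    using pCons assms(1) by (auto simp: over_pCons intro: rational_add rational_mult rational_const)
qed

text \<open>
  \<open>(P / Q) \<circ> G\<close> is the quotient of \<open>P \<circ> G\<close> by \<open>Q \<circ> G\<close>, and the latter still has the constant term
  of \<open>Q\<close> because \<open>G\<close> vanishes at the origin.
\<close>

lemma rational_compose:
  assumes "rational F" "rational G" "fps_nth G 0 = 0"
  shows "rational (F oo G)"
proof -
  obtain P Q where F: "over P" "over Q" "coeff Q 0 \<noteq> 0" "F * fps_of_poly Q = fps_of_poly P"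
    using assms(1) by (rule rationalE)
  let ?Q = "fps_of_poly Q oo G"
  have Q0: "fps_nth ?Q 0 \<noteq> 0"
    using F(3) by simp
  have "(F oo G) * ?Q = fps_of_poly P oo G"
    by (simp add: fps_compose_mult_distrib[OF assms(3)] flip: F(4))
  then have "(fps_of_poly P oo G) * inverse ?Q = (F oo G) * (?Q * inverse ?Q)"
    by (simp only: mult.assoc flip: \<open>(F oo G) * ?Q = fps_of_poly P oo G\<close>)
  also have "\<dots> = F oo G"
    using inverse_mult_eq_1[OF Q0] by (simp add: mult.commute)
  finally show ?thesis
    using rational_mult[OF rational_poly_compose rational_inverse[OF rational_poly_compose Q0]]
      assms(2,3) F(1,2) by metis
qed

lemma constructible_imp_rational:
  assumes "constructible K F" "K \<subseteq> E"
  shows "rational F"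
  using assms
  by (induction rule: constructible.induct)
     (auto intro: rational_X rational_const rational_add rational_mult rational_deriv
       rational_compose rational_inverse)

end

section \<open>Coefficients of rational series at linear cost\<close>

text \<open>
  The subfield is described by its input-free circuits, so that a number known to lie in it comes
  with a circuit computing it.  Negatives are reached as \<open>0 - a\<close>.
\<close>

definition generated_field :: "complex set \<Rightarrow> complex set" where
  "generated_field K = {z. arithmetic (K \<union> {0, 1}) 0 (\<lambda>_. z)}"

interpretation gen: complex_subfield "generated_field K" for K
proof
  have gate: "arithmetic (K \<union> {0, 1}) 0 (\<lambda>_. apply_op opr a b)"
    if "arithmetic (K \<union> {0, 1}) 0 (\<lambda>_. a)" "arithmetic (K \<union> {0, 1}) 0 (\<lambda>_. b)"
      "opr = Div \<Longrightarrow> b \<noteq> 0" for opr a b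
    by (rule arithmetic.gate) (use that in auto)
  show "0 \<in> generated_field K" "1 \<in> generated_field K"
    by (auto simp: generated_field_def intro: arithmetic.scalar)
  fix a b assume ab: "a \<in> generated_field K" "b \<in> generated_field K"
  show "a + b \<in> generated_field K" "a - b \<in> generated_field K" "a * b \<in> generated_field K"
    using gate[of a b Add] gate[of a b Sub] gate[of a b Mul] ab
    by (simp_all add: generated_field_def)
  show "a / b \<in> generated_field K" if "b \<noteq> 0"
    using gate[of a b Div] ab that by (simp add: generated_field_def)
qed

lemma generators_subset: "K \<subseteq> generated_field K"
  by (auto simp: generated_field_def intro: arithmetic.scalar)

lemma jointly_computable_diff_inner_product:
  assumes "jointly_computable K n c S" "s \<in> S"
    and "\<And>i. i < d \<Longrightarrow> a i \<in> S" "\<And>i. i < d \<Longrightarrow> b i \<in> S"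
  shows "jointly_computable K n (c + 2 * d) (insert (\<lambda>xs. s xs - (\<Sum>i<d. a i xs * b i xs)) S)"
  using assms(3,4)
proof (induction d)
  case 0
  then show ?case
    using assms(1,2) by (simp add: insert_absorb)
next
  case (Suc d)
  let ?t = "\<lambda>xs. s xs - (\<Sum>i<d. a i xs * b i xs)"
  let ?p = "\<lambda>xs. apply_op Mul (a d xs) (b d xs)"
  have "jointly_computable K n (c + 2 * d) (insert ?t S)"
    using Suc by simp
  then have "jointly_computable K n (Suc (c + 2 * d)) (insert ?p (insert ?t S))"
    by (rule jointly_computable_gate) (use Suc.prems in auto)
  then have "jointly_computable K n (Suc (Suc (c + 2 * d)))
      (insert (\<lambda>xs. apply_op Sub (?t xs) (?p xs)) (insert ?p (insert ?t S)))"
    by (rule jointly_computable_gate) auto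
  then have sub: "jointly_computable K n (Suc (Suc (c + 2 * d)))
      (insert (\<lambda>xs. apply_op Sub (?t xs) (?p xs)) S)"
    by (rule jointly_computable_subset) blast
  have diff: "(\<lambda>xs. apply_op Sub (?t xs) (?p xs))
      = (\<lambda>xs. s xs - (\<Sum>i<Suc d. a i xs * b i xs))"
    by (rule ext) simp
  have size: "Suc (Suc (c + 2 * d)) = c + 2 * Suc d"
    by simp
  show ?case
    using sub unfolding diff size .
qed

text \<open>
  Coefficients of negative index are read as \<open>0\<close>, so that the sum has the same length
  \<open>degree Q\<close> for every \<open>n\<close>, including the first few.
\<close>

lemma rational_recurrence:
  fixes F :: "complex fps"
  assumes "F * fps_of_poly Q = fps_of_poly P" "coeff Q 0 \<noteq> 0"
  shows "fps_nth F n = (coeff P n - (\<Sum>i<degree Q.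
    coeff Q (Suc i) * (if i < n then fps_nth F (n - Suc i) else 0))) / coeff Q 0"
proof -
  let ?t = "\<lambda>i. coeff Q (Suc i) * (if i < n then fps_nth F (n - Suc i) else 0)"
  have "coeff P n = fps_nth (fps_of_poly Q * F) n"
    by (simp add: mult.commute assms(1))
  also have "\<dots> = (\<Sum>i\<le>n. coeff Q i * fps_nth F (n - i))"
    by (simp add: fps_mult_nth atLeast0AtMost)
  also have "\<dots> = coeff Q 0 * fps_nth F n + (\<Sum>i<n. coeff Q (Suc i) * fps_nth F (n - Suc i))"
    by (simp add: sum.atMost_shift)
  also have "(\<Sum>i<n. coeff Q (Suc i) * fps_nth F (n - Suc i)) = (\<Sum>i<degree Q. ?t i)"
  proof -
    have "(\<Sum>i<n. coeff Q (Suc i) * fps_nth F (n - Suc i)) = (\<Sum>i<n + degree Q. ?t i)"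
      by (rule sum.mono_neutral_cong_left) auto
    also have "\<dots> = (\<Sum>i<degree Q. ?t i)"
      by (rule sum.mono_neutral_right) (auto simp: coeff_eq_0)
    finally show ?thesis .
  qed
  finally show ?thesis
    using assms(2) by (simp add: field_simps)
qed

text \<open>
  The recurrence takes \<open>2 * degree Q + 1\<close> gates per coefficient: \<open>degree Q\<close> products, as many
  subtractions, and a division by the constant term of \<open>Q\<close>.
\<close>

lemma eval_cost_linear:
  assumes "constructible K F"
  shows "\<exists>C. \<forall>m. eval_cost K F m \<le> C * Suc m"
proof -
  let ?K = "K \<union> {0, 1}"
  have "gen.rational K F"
    using assms generators_subset by (rule gen.constructible_imp_rational)
  then obtain P Q where P: "gen.over K P" and Q: "gen.over K Q" and Q0: "coeff Q 0 \<noteq> 0"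
    and FQ: "F * fps_of_poly Q = fps_of_poly P"
    by (rule gen.rationalE)
  define T :: "(complex list \<Rightarrow> complex) set"
    where "T = (\<lambda>z _. z) ` (insert 0 (range (coeff P) \<union> range (coeff Q)))"
  have "finite (range (coeff R))" for R :: "complex poly"
  proof (rule finite_subset)
    show "range (coeff R) \<subseteq> insert 0 (coeff R ` {..degree R})"
      using le_degree by fastforce
  qed simp
  then have "finite T"
    by (simp add: T_def)
  moreover have "z \<in> generated_field K" if "(\<lambda>_. z) \<in> T" for z
    using that P Q gen.zero_mem[of K] unfolding T_def gen.over_def by (auto dest: fun_cong)
  then have "arithmetic ?K 0 f" if "f \<in> T" for f
    using that by (auto simp: T_def generated_field_def)
  ultimately obtain c where c: "jointly_computable ?K 0 c T"
    using arithmetic_finite by blast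
  define e where "e = 2 * degree Q + 1"
  have step: "jointly_computable ?K 0 (c + e * n) (T \<union> (\<lambda>k _. fps_nth F k) ` {..<n})" for n
  proof (induction n)
    case 0
    then show ?case
      using c by simp
  next
    case (Suc n)
    let ?S = "T \<union> (\<lambda>k _. fps_nth F k) ` {..<n}"
    let ?b = "\<lambda>i. if i < n then fps_nth F (n - Suc i) else 0"
    let ?num = "\<lambda>_::complex list. coeff P n - (\<Sum>i<degree Q. coeff Q (Suc i) * ?b i)"
    have "jointly_computable ?K 0 (c + e * n + 2 * degree Q) (insert ?num ?S)"
      by (rule jointly_computable_diff_inner_product
            [OF Suc, where a = "\<lambda>i _. coeff Q (Suc i)" and b = "\<lambda>i _. ?b i"])
         (auto simp: T_def)
    then have quot: "jointly_computable ?K 0 (Suc (c + e * n + 2 * degree Q))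
        (insert (\<lambda>xs. apply_op Div (?num xs) (coeff Q 0)) (insert ?num ?S))"
      by (rule jointly_computable_gate[where g = "\<lambda>_. coeff Q 0"]) (auto simp: T_def Q0)
    have coeff_F: "apply_op Div (?num xs) (coeff Q 0) = fps_nth F n" for xs
      using rational_recurrence[OF FQ Q0, of n] by simp
    have size: "Suc (c + e * n + 2 * degree Q) = c + e * Suc n"
      by (simp add: e_def)
    have "jointly_computable ?K 0 (c + e * Suc n)
        (insert (\<lambda>_. fps_nth F n) (insert ?num ?S))"
      using quot unfolding coeff_F size .
    then show ?case
      by (rule jointly_computable_subset) (auto simp: lessThan_Suc)
  qed
  have "eval_cost K F m \<le> (c + e) * Suc m" for m
  proof -
    have "eval_cost K F m \<le> c + e * Suc m"
      unfolding eval_cost_def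
    proof (rule circuit_cost_le[OF step])
      show "set (map (\<lambda>k _. fps_nth F k) [0..<Suc m]) \<subseteq> T \<union> (\<lambda>k _. fps_nth F k) ` {..<Suc m}"
        by auto
      show "coords m (eval_trunc m F (nilp m))
          = map (\<lambda>f. f xs) (map (\<lambda>k _. fps_nth F k) [0..<Suc m])" for xs
        by (simp add: coords_eval_trunc_nilp)
    qed
    then show ?thesis
      by (simp add: algebra_simps)
  qed
  then show ?thesis
    by blast
qed

theorem theorem1:
  fixes K :: "complex set" and M :: "nat \<Rightarrow> real"
  assumes mult: "\<And>m. real (mult_cost m) \<le> M m"
    and superadditive: "\<And>n. n \<ge> 1 \<Longrightarrow> M (2 * n) \<ge> 2 * M n"
  shows "(\<forall>F :: complex fps. constructible K F \<longrightarrow>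
            (\<lambda>m. real (eval_cost K F m)) \<in> O(M)) \<and>
         (\<forall>f :: complex \<Rightarrow> complex. f analytic_on {0} \<and> constructible K (fps_expansion f 0) \<longrightarrow>
            (\<lambda>m. real (eval_cost K (fps_expansion f 0) m)) \<in> O(M))"
proof -
  have "(\<lambda>m. real (eval_cost K F m)) \<in> O(M)" if F: "constructible K F" for F
  proof -
    obtain C where C: "\<And>m. eval_cost K F m \<le> C * Suc m"
      using eval_cost_linear[OF F] by blast
    have "norm (real (eval_cost K F m)) \<le> real C * norm (M m)" for m
    proof -
      have "real (eval_cost K F m) \<le> real C * real (Suc m)"
        using C[of m] by (metis of_nat_le_iff of_nat_mult)
      also have "real (Suc m) \<le> M m"
        using mult_cost_lower_bound[of m] mult[of m] by linarith
      finally show ?thesis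
        by (simp add: mult_left_mono order_trans)
    qed
    then show ?thesis
      by (intro bigoI[of _ "real C"]) simp
  qed
  then show ?thesis
    by blast
qed

end
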